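(* Let $k$ be a field of characteristic $p=3$. Let $r\ge1$ be an integer and let $\varrho:(\mathbb{Z}/p\mathbb{Z})^r\to GL(4,k)$ be a (modular) representation. Then $\varrho$ is equivalent to a representation $\varrho':(\mathbb{Z}/p\mathbb{Z})^r\to GL(4,k)$ such that the matrices $\varrho'(e_i)$ $(1\le i\le r)$ have (simultaneously for all $i$) one of the following forms (1), (2), (3), (4), (5), (6), with $\alpha_i,\beta_i,\gamma_i,\delta_i\in k$: (1) $\begin{pmatrix}1&\alpha_i&\beta_i&\gamma_i\\0&1&\alpha_i&0\\0&0&1&0\\0&0&0&1\end{pmatrix}$ $(1\le i\le r)$. (2) $\begin{pmatrix}1&0&0&\gamma_i\\0&1&\alpha_i&\beta_i\\0&0&1&\alpha_i\\0&0&0&1\end{pmatrix}$ $(1\le i\le r)$. (3) $\begin{pmatrix}1&\alpha_i&\beta_i&\gamma_i\\0&1&0&0\\0&0&1&0\\0&0&0&1\end{pmatrix}$ $(1\le i\le r)$. (4) $\begin{pmatrix}1&0&\alpha_i&\beta_i\\0&1&\gamma_i&\delta_i\\0&0&1&0\\0&0&0&1\end{pmatrix}$ $(1\le i\le r)$. (5) $\begin{pmatrix}1&0&0&\alpha_i\\0&1&0&\beta_i\\0&0&1&\gamma_i\\0&0&0&1\end{pmatrix}$ $(1\le i\le r)$. (6) $\begin{pmatrix}1&\alpha_i&\beta_i&\gamma_i\\0&1&0&\lambda\alpha_i+\mu\beta_i\\0&0&1&\mu\alpha_i+\nu\beta_i\\0&0&0&1\end{pmatrix}$ $(1\le i\le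 r)$, having constants $\lambda,\mu,\nu\in k$ (independent of $i$) with $\lambda\nu-\mu^2\ne0$.
   Context: $e_1,\dots,e_r$ are the standard generators of $(\mathbb{Z}/p\mathbb{Z})^r$ ($e_i$ has $i$-th entry $[1]$ and other entries $[0]$). Representations $\varrho,\varrho'$ into $GL(4,k)$ are equivalent if there is $P\in GL(4,k)$ with $P^{-1}\varrho(g)P=\varrho'(g)$ for all $g$. (Every representation of $(\mathbb{Z}/p\mathbb{Z})^r$, $r\ge1$, over a field of characteristic $p$ is modular, i.e. $p$ divides the group order.) *)

theory Defs
  imports
    "HOL-Analysis.Analysis"
    "HOL-Algebra.Elementary_Groups"
    "HOL-Algebra.Product_Groups"
begin

definition general_linear_group :: "('k::field^'n^'n) monoid"
  where "general_linear_group =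
    \<lparr>carrier = {A. invertible A}, monoid.mult = (**), one = mat 1\<rparr>"

lemma group_general_linear_group: "group (general_linear_group :: ('k::field^'n^'n) monoid)"
proof (rule groupI)
  fix A :: "'k^'n^'n"
  assume "A \<in> carrier general_linear_group"
  then obtain B where "A ** B = mat 1" "B ** A = mat 1"
    by (auto simp: general_linear_group_def invertible_def)
  then show "\<exists>B\<in>carrier general_linear_group.
      B \<otimes>\<^bsub>general_linear_group\<^esub> A = \<one>\<^bsub>general_linear_group\<^esub>"
    by (auto simp: general_linear_group_def invertible_def)
qed (auto simp: general_linear_group_def invertible_mult matrix_mul_assoc invertible_def[of "mat 1"])

(* (Z/pZ)^r; its elements are functions on {1..r} that are undefined elsewhere, with values
   the residue representatives in {0..<p}. *)
definition elementary_abelian_group :: "nat \<Rightarrow> nat \<Rightarrow> (nat \<Rightarrow> int) monoid"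
  where "elementary_abelian_group p r = product_group {1..r} (\<lambda>_. integer_mod_group p)"

definition std_gen :: "nat \<Rightarrow> nat \<Rightarrow> nat \<Rightarrow> (nat \<Rightarrow> int)"
  where "std_gen p r i = (\<lambda>j\<in>{1..r}. if j = i then 1 mod int p else 0)"

lemma group_elementary_abelian_group: "group (elementary_abelian_group p r)"
  by (simp add: elementary_abelian_group_def)

lemma std_gen_in_carrier:
  "p > 0 \<Longrightarrow> std_gen p r i \<in> carrier (elementary_abelian_group p r)"
  by (auto simp: std_gen_def elementary_abelian_group_def carrier_integer_mod_group)

definition matrix_representation ::
    "('g, 'm) monoid_scheme \<Rightarrow> ('g \<Rightarrow> 'k::field^'n^'n) \<Rightarrow> bool"
  where "matrix_representation G \<rho> \<longleftrightarrow> \<rho> \<in> hom G general_linear_group"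

definition equivalent_representations ::
    "('g, 'm) monoid_scheme \<Rightarrow> ('g \<Rightarrow> 'k::field^'n^'n) \<Rightarrow> ('g \<Rightarrow> 'k^'n^'n) \<Rightarrow> bool"
  where "equivalent_representations G \<rho> \<rho>' \<longleftrightarrow>
    (\<exists>P\<in>carrier general_linear_group. \<forall>g\<in>carrier G. matrix_inv P ** \<rho> g ** P = \<rho>' g)"

definition matrix4 :: "'k::field list list \<Rightarrow> 'k^4^4"
  where "matrix4 xss = vector (map vector xss)"

lemma matrix4_nth [simp]:
  fixes R1 R2 R3 R4 :: "'k::field list"
  shows "matrix4 [R1, R2, R3, R4] $ 1 = vector R1"
    and "matrix4 [R1, R2, R3, R4] $ 2 = vector R2"
    and "matrix4 [R1, R2, R3, R4] $ 3 = vector R3"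
    and "matrix4 [R1, R2, R3, R4] $ 4 = vector R4"
  by (simp_all add: matrix4_def vector_def)

lemma vector_4 [simp]:
  fixes a b c d :: "'k::zero"
  shows "(vector [a, b, c, d] :: 'k^4) $ 1 = a"
    and "(vector [a, b, c, d] :: 'k^4) $ 2 = b"
    and "(vector [a, b, c, d] :: 'k^4) $ 3 = c"
    and "(vector [a, b, c, d] :: 'k^4) $ 4 = d"
  by (simp_all add: vector_def)

end

theory Submission
  imports Defs
begin

text \<open>
  The matrices \<open>X = \<rho> g - 1\<close> commute, and in characteristic 3 they satisfy \<open>X\<^sup>3 = 0\<close>. Together
  with dimension 4 this forces all triple products \<open>X Y Z\<close> to vanish: otherwise the images of a
  vector \<open>v\<close> under suitable monomials would be five independent vectors. If all products \<open>X Y\<close>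
  vanish, the common image lies in the common kernel and its dimension (at most 1, 2 or 3) gives
  the forms (3), (4), (5). If some \<open>X\<^sup>2 v \<noteq> 0\<close>, complete \<open>X\<^sup>2 v, X v, v\<close> to a basis by a vector \<open>w\<close>
  killed by \<open>X\<close>: if no \<open>Y v\<close> leaves their span, this gives form (1); otherwise one may take
  \<open>w = Y v - t X v\<close>, and \<open>Y w = \<kappa> X\<^sup>2 v\<close> gives form (2) or (6) according to whether \<open>\<kappa> = 0\<close>.
  If all squares vanish but \<open>X Y v \<noteq> 0\<close>, the basis \<open>X Y v, X v, Y v, v\<close> gives form (6) with the
  hyperbolic plane as quadratic form.
\<close>

section \<open>Bases of the four-dimensional space and changes of basis\<close>

text \<open>Since \<open>vector\<close> lists rows, the transpose is taken to make the four vectors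
  columns; an invertible frame is thus a change of basis matrix.\<close>

definition frame :: "'k::field^4 \<Rightarrow> 'k^4 \<Rightarrow> 'k^4 \<Rightarrow> 'k^4 \<Rightarrow> 'k^4^4"
  where "frame a b c d = transpose (vector [a, b, c, d])"

lemma frame_mult_vec:
  "frame a b c d *v x = x $ 1 *s a + x $ 2 *s b + x $ 3 *s c + x $ 4 *s d"
  by (simp add: frame_def vec_eq_iff matrix_vector_mult_def transpose_def sum_4 mult.commute)

text \<open>A square matrix is invertible exactly if its kernel is trivial, and the kernel consists
  of the coefficient vectors of linear relations among the columns.\<close>

lemma invertible_frame_iff:
  "invertible (frame a b c d) \<longleftrightarrow>
    (\<forall>p q s t. p *s a + q *s b + s *s c + t *s d = 0 \<longrightarrow> p = 0 \<and> q = 0 \<and> s = 0 \<and> t = 0)"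
  (is "_ \<longleftrightarrow> ?R")
proof -
  have ker: "invertible (frame a b c d) \<longleftrightarrow> (\<forall>x. frame a b c d *v x = 0 \<longrightarrow> x = 0)"
    by (simp only: invertible_left_inverse matrix_left_invertible_ker)
  show ?thesis
  proof
    assume L: "invertible (frame a b c d)"
    show ?R
    proof (intro allI impI)
      fix p q s t
      assume "p *s a + q *s b + s *s c + t *s d = 0"
      then have "frame a b c d *v vector [p, q, s, t] = 0"
        by (simp add: frame_mult_vec)
      then have "(vector [p, q, s, t] :: 'a^4) = 0"
        using L ker by blast
      then show "p = 0 \<and> q = 0 \<and> s = 0 \<and> t = 0"
        by (simp add: vec_eq_iff forall_4)
    qed
  next
    assume R: ?R
    have "x = 0" if "frame a b c d *v x = 0" for x
    proof -
      have "x $ 1 = 0 \<and> x $ 2 = 0 \<and> x $ 3 = 0 \<and> x $ 4 = 0"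
        using R that unfolding frame_mult_vec by blast
      then show "x = 0"
        by (simp add: vec_eq_iff forall_4)
    qed
    then show "invertible (frame a b c d)"
      using ker by blast
  qed
qed

lemma frame_expand:
  assumes "invertible (frame a b c d)"
  obtains p q s t where "x = p *s a + q *s b + s *s c + t *s d"
proof -
  obtain y where "x = frame a b c d *v y"
    using assms by (metis invertible_def matrix_vector_mul_assoc matrix_vector_mul_lid)
  then show ?thesis
    using that by (simp add: frame_mult_vec)
qed

lemma in_span_1_iff: "x \<in> vec.span {a} \<longleftrightarrow> (\<exists>p. x = p *s a)"
  by (auto simp: vec.span_singleton)

lemma in_span_2_iff: "x \<in> vec.span {a, b} \<longleftrightarrow> (\<exists>p q. x = p *s a + q *s b)"
  by (auto simp: vec.span_insert vec.span_singleton diff_eq_eq add.commute)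

lemma in_span_3_iff:
  "x \<in> vec.span {a, b, c} \<longleftrightarrow> (\<exists>p q s. x = p *s a + q *s b + s *s c)"
proof -
  have "x \<in> vec.span {a, b, c} \<longleftrightarrow> (\<exists>p. x - p *s a \<in> vec.span {b, c})"
    by (simp add: vec.span_insert)
  then show ?thesis
    by (simp add: in_span_2_iff diff_eq_eq ac_simps)
qed

text \<open>Three vectors cannot span a space of dimension four. The vectors may coincide, so one or
  two given vectors can be extended in the same way.\<close>

lemma exists_notin_span:
  fixes a b c :: "'k::field^4"
  shows "\<exists>x. x \<notin> vec.span {a, b, c}"
proof -
  have "vec.dim (vec.span {a, b, c}) \<le> card {a, b, c}"
    by (intro vec.dim_le_card) auto
  moreover have "card {a, b, c} \<le> 3"
    by (simp add: card_insert_if)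
  ultimately have "vec.span {a, b, c} \<noteq> UNIV"
    using vec_dim_card[where 'a='k and 'n=4] by fastforce
  then show ?thesis by blast
qed

lemma coeff_zero_if_relation:
  assumes "t *s d + u = 0" "u \<in> vec.span S" "d \<notin> vec.span S"
  shows "t = 0"
proof (rule ccontr)
  assume t: "t \<noteq> 0"
  have "t *s d = - u" using assms(1) by (simp add: eq_neg_iff_add_eq_0)
  then have "inverse t *s (t *s d) \<in> vec.span S"
    using assms(2) by (metis vec.span_neg vec.span_scale)
  then show False using t assms(3) by simp
qed

text \<open>In a linear relation the coefficients vanish one after the other, from the last vector
  back to the first, because each vector lies outside the span of its predecessors.\<close>

lemma invertible_frameI:
  assumes "a \<noteq> 0" "b \<notin> vec.span {a}" "c \<notin> vec.span {a, b}" "d \<notin> vec.span {a, b, c}"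
  shows "invertible (frame a b c d)"
  unfolding invertible_frame_iff
proof (intro allI impI)
  fix p q s t
  assume rel: "p *s a + q *s b + s *s c + t *s d = 0"
  have t: "t = 0"
  proof (rule coeff_zero_if_relation[OF _ _ assms(4)])
    show "t *s d + (p *s a + q *s b + s *s c) = 0" using rel by (simp only: ac_simps)
  qed (auto simp: in_span_3_iff)
  have s: "s = 0"
  proof (rule coeff_zero_if_relation[OF _ _ assms(3)])
    show "s *s c + (p *s a + q *s b) = 0" using rel t by (simp add: ac_simps)
  qed (auto simp: in_span_2_iff)
  have q: "q = 0"
  proof (rule coeff_zero_if_relation[OF _ _ assms(2)])
    show "q *s b + p *s a = 0" using rel s t by (simp add: ac_simps)
  qed (auto simp: vec.span_singleton)
  show "p = 0 \<and> q = 0 \<and> s = 0 \<and> t = 0"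
    using rel q s t assms(1) by simp
qed

lemma invertible_frame_rotate:
  assumes "invertible (frame a b c d)"
  shows "invertible (frame d a b c)"
  unfolding invertible_frame_iff
proof (intro allI impI)
  fix p q s t
  assume "p *s d + q *s a + s *s b + t *s c = 0"
  then have "q *s a + s *s b + t *s c + p *s d = 0" by (simp only: ac_simps)
  then show "p = 0 \<and> q = 0 \<and> s = 0 \<and> t = 0"
    using assms unfolding invertible_frame_iff by blast
qed

lemma invertible_frame_swap:
  assumes "invertible (frame a b c d)"
  shows "invertible (frame a b d c)"
  unfolding invertible_frame_iff
proof (intro allI impI)
  fix p q s t
  assume "p *s a + q *s b + s *s d + t *s c = 0"
  then have "p *s a + q *s b + t *s c + s *s d = 0" by (simp only: ac_simps)
  then show "p = 0 \<and> q = 0 \<and> s = 0 \<and> t = 0"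
    using assms unfolding invertible_frame_iff by blast
qed

text \<open>If \<open>s\<close> is nonzero, the relation can be solved for \<open>x\<close>; if
  \<open>s = 0\<close>, then \<open>r = 0\<close> because \<open>y\<close> is nonzero, and the last
  hypothesis applies. In the uses below the relation mostly arises by applying a matrix to an
  expansion in a basis; when both coefficients vanish, the shortened expansion itself gives the
  claim.\<close>

lemma in_line_if_relation:
  fixes x y :: "'k::field^'n"
  assumes "r *s y + s *s x = 0" "y \<noteq> 0" "r = 0 \<Longrightarrow> s = 0 \<Longrightarrow> \<exists>t. x = t *s y"
  shows "\<exists>t. x = t *s y"
proof (cases "s = 0")
  case True
  then show ?thesis using assms by simp
next
  case False
  have "s *s x = (- r) *s y"
    using assms(1) by (simp add: eq_neg_iff_add_eq_0 add.commute)
  then have "x = (inverse s * - r) *s y"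
    using False by (metis vec.scale_left_imp_eq vec.scale_scale right_inverse mult.assoc mult_1)
  then show ?thesis by blast
qed

text \<open>The bound on the dimension in the form used for contradictions: the first four vectors
  would be a basis, and expanding the fifth one in it gives a relation with coefficient
  \<open>- 1\<close>.\<close>

lemma five_vectors_dependent:
  fixes a b c d e :: "'k::field^4"
  assumes "\<And>p q s t u. p *s a + q *s b + s *s c + t *s d + u *s e = 0 \<Longrightarrow>
    p = 0 \<and> q = 0 \<and> s = 0 \<and> t = 0 \<and> u = 0"
  shows False
proof -
  have "invertible (frame a b c d)"
    using assms[of _ _ _ _ 0] by (simp add: invertible_frame_iff)
  then obtain p q s t where "e = p *s a + q *s b + s *s c + t *s d"
    by (rule frame_expand)
  then have "p *s a + q *s b + s *s c + t *s d + (- 1) *s e = 0" by simp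
  then show False using assms by fastforce
qed

text \<open>Both sides are compared column by column: the columns of the coefficient matrix are the
  coordinates of the images of the basis vectors. Each normal form thus becomes a statement about
  the images of four vectors.\<close>

lemma frame_intertwines_iff:
  "A ** frame a b c d = frame a b c d ** matrix4
     [[p11, p12, p13, p14], [p21, p22, p23, p24], [p31, p32, p33, p34], [p41, p42, p43, p44]] \<longleftrightarrow>
   A *v a = p11 *s a + p21 *s b + p31 *s c + p41 *s d \<and>
   A *v b = p12 *s a + p22 *s b + p32 *s c + p42 *s d \<and>
   A *v c = p13 *s a + p23 *s b + p33 *s c + p43 *s d \<and>
   A *v d = p14 *s a + p24 *s b + p34 *s c + p44 *s d" (is "_ = _ ** ?C \<longleftrightarrow> _")
proof -
  have cols: "column 1 (B ** frame a b c d) = B *v a" "column 2 (B ** frame a b c d) = B *v b"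
    "column 3 (B ** frame a b c d) = B *v c" "column 4 (B ** frame a b c d) = B *v d" for B :: "'a^4^4"
    by (simp_all add: vec_eq_iff column_def matrix_matrix_mult_def matrix_vector_mult_def
        frame_def transpose_def)
  have "M = N \<longleftrightarrow> (\<forall>j. column j M = column j N)" for M N :: "'a^4^4"
    by (auto simp: vec_eq_iff column_def)
  moreover have "column j (frame a b c d ** ?C) = frame a b c d *v column j ?C" for j
    by (simp add: vec_eq_iff column_def matrix_matrix_mult_def matrix_vector_mult_def)
  ultimately show ?thesis
    by (simp add: forall_4 cols frame_mult_vec) (simp add: column_def)
qed


section \<open>Commuting matrices with vanishing cubes, and the vanishing of all triple
  products\<close>

text \<open>\<open>M\<close> stands for the set of matrices \<open>\<rho> g - 1\<close>. The axioms
  speak of the action on vectors because every argument follows the images of a single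
  vector.\<close>

locale commuting_cube_zero =
  fixes M :: "('k::field^4^4) set"
  assumes commute: "X \<in> M \<Longrightarrow> Y \<in> M \<Longrightarrow> X *v (Y *v v) = Y *v (X *v v)"
    and cube: "X \<in> M \<Longrightarrow> X *v (X *v (X *v v)) = 0"
begin

lemmas mult_vec_simps = matrix_vector_right_distrib vector_scalar_commute matrix_vector_mul_assoc[symmetric]

text \<open>If the product were nonzero at \<open>v\<close>, then \<open>v\<close>,
  \<open>X v\<close>, \<open>Y v\<close>, \<open>X X v\<close> and \<open>X Y v\<close> would be
  five independent vectors: multiplying a relation by suitable monomials in \<open>X\<close> and
  \<open>Y\<close> isolates one coefficient at a time.\<close>

lemma square_mult:
  assumes X: "X \<in> M" and Y: "Y \<in> M"
  shows "X *v (X *v (Y *v v)) = 0"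
proof (rule ccontr)
  assume nz: "X *v (X *v (Y *v v)) \<noteq> 0"
  have YX: "Y *v (X *v u) = X *v (Y *v u)" for u
    using commute X Y by blast
  note rules = mult_vec_simps YX cube[OF X] cube[OF Y]
  show False
  proof (rule five_vectors_dependent)
    fix p q r s t
    assume rel: "p *s v + q *s (X *v v) + r *s (Y *v v) + s *s (X *v (X *v v))
      + t *s (X *v (Y *v v)) = 0"
    have app: "A *v (p *s v + q *s (X *v v) + r *s (Y *v v) + s *s (X *v (X *v v))
      + t *s (X *v (Y *v v))) = 0" for A :: "'k^4^4"
      using rel by simp
    have p: "p = 0"
    \<comment> \<open>The multiplier is the highest monomial that does not kill \<open>v\<close>:
      \<open>X X Y\<close> if \<open>X X Y Y v\<close> vanishes, and \<open>X X Y Y\<close>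
      otherwise. It kills every term of the relation except the one with \<open>p\<close>.\<close>
    proof (cases "X *v (X *v (Y *v (Y *v v))) = 0")
      case True
      then show ?thesis using app[of "X ** X ** Y"] nz by (simp add: rules)
    next
      case False
      then show ?thesis using app[of "X ** X ** Y ** Y"] by (simp add: rules)
    qed
    have r: "r = 0" using app[of "X ** X"] nz p by (simp add: rules)
    have q: "q = 0"
    proof (cases "X *v (X *v (Y *v (Y *v v))) = 0")
      case True
      then show ?thesis using app[of "X ** Y"] nz p r by (simp add: rules)
    next
      case False
      then show ?thesis using app[of "X ** Y ** Y"] p r by (simp add: rules)
    qed
    have t: "t = 0" using app[of X] nz p q r by (simp add: rules)
    have "s = 0" using app[of Y] nz p q r t by (simp add: rules)
    with p q r t show "p = 0 \<and> q = 0 \<and> r = 0 \<and> s = 0 \<and> t = 0" by simp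
  qed
qed

text \<open>By \<open>square_mult\<close> every product of three factors with a repetition is zero.
  If \<open>X Y Z v\<close> were nonzero, then multiplying by \<open>X Y Z\<close> and by the
  products of two of the matrices would show that \<open>v\<close>, \<open>X v\<close>,
  \<open>Y v\<close>, \<open>Z v\<close>, \<open>X Y Z v\<close> are five independent
  vectors.\<close>

lemma triple_zero:
  assumes X: "X \<in> M" and Y: "Y \<in> M" and Z: "Z \<in> M"
  shows "X *v (Y *v (Z *v v)) = 0"
proof (rule ccontr)
  assume nz: "X *v (Y *v (Z *v v)) \<noteq> 0"
  have comm: "Y *v (X *v u) = X *v (Y *v u)" "Z *v (X *v u) = X *v (Z *v u)"
    "Z *v (Y *v u) = Y *v (Z *v u)" for u
    using commute X Y Z by blast+
  have sq: "X *v (X *v (Y *v u)) = 0" "X *v (X *v (Z *v u)) = 0" "Y *v (Y *v (Z *v u)) = 0"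
    "X *v (Y *v (Y *v u)) = 0" "X *v (Z *v (Z *v u)) = 0" "Y *v (Z *v (Z *v u)) = 0" for u
    using square_mult[OF X Y] square_mult[OF X Z] square_mult[OF Y Z] square_mult[OF Y X, of u]
      square_mult[OF Z X, of u] square_mult[OF Z Y, of u] by (simp_all add: comm)
  note rules = mult_vec_simps comm sq cube[OF X] cube[OF Y] cube[OF Z]
  show False
  proof (rule five_vectors_dependent)
    fix p q r s t
    assume rel: "p *s v + q *s (X *v v) + r *s (Y *v v) + s *s (Z *v v)
      + t *s (X *v (Y *v (Z *v v))) = 0"
    have app: "A *v (p *s v + q *s (X *v v) + r *s (Y *v v) + s *s (Z *v v)
      + t *s (X *v (Y *v (Z *v v)))) = 0" for A :: "'k^4^4"
      using rel by simp
    have p: "p = 0" using app[of "X ** Y ** Z"] nz by (simp add: rules)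
    have q: "q = 0" using app[of "Y ** Z"] nz p by (simp add: rules)
    have r: "r = 0" using app[of "X ** Z"] nz p by (simp add: rules)
    have s: "s = 0" using app[of "X ** Y"] nz p by (simp add: rules)
    have "t = 0" using rel nz p q r s by simp
    with p q r s show "p = 0 \<and> q = 0 \<and> r = 0 \<and> s = 0 \<and> t = 0" by simp
  qed
qed

section \<open>All products vanish\<close>

text \<open>Images of members of \<open>M\<close> are killed by all of \<open>M\<close>. The vectors
  \<open>a\<close>, \<open>b\<close>, \<open>c\<close> are taken from these images as long as the
  span of those already chosen does not contain all images; the point at which this stops decides
  between the three forms.\<close>

lemma products_zero_cases:
  assumes zero: "\<And>X Y v. X \<in> M \<Longrightarrow> Y \<in> M \<Longrightarrow> X *v (Y *v v) = 0"
  shows "(\<exists>P. invertible P \<and> (\<forall>X\<in>M. \<exists>\<alpha> \<beta> \<gamma>. (mat 1 + X) ** P = P ** matrix4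
        [[1, \<alpha>, \<beta>, \<gamma>], [0, 1, 0, 0], [0, 0, 1, 0], [0, 0, 0, 1]])) \<or>
    (\<exists>P. invertible P \<and> (\<forall>X\<in>M. \<exists>\<alpha> \<beta> \<gamma> \<delta>. (mat 1 + X) ** P = P ** matrix4
        [[1, 0, \<alpha>, \<beta>], [0, 1, \<gamma>, \<delta>], [0, 0, 1, 0], [0, 0, 0, 1]])) \<or>
    (\<exists>P. invertible P \<and> (\<forall>X\<in>M. \<exists>\<alpha> \<beta> \<gamma>. (mat 1 + X) ** P = P ** matrix4
        [[1, 0, 0, \<alpha>], [0, 1, 0, \<beta>], [0, 0, 1, \<gamma>], [0, 0, 0, 1]]))"
    (is "?F3 \<or> ?F4 \<or> ?F5")
proof -
  obtain a where a: "a \<noteq> 0" "\<forall>X\<in>M. X *v a = 0"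
  proof (cases "\<forall>X\<in>M. \<forall>v. X *v v = 0")
    case True
    \<comment> \<open>Here all matrices are zero, so any nonzero vector can serve as
      \<open>a\<close>.\<close>
    then show ?thesis using that[of "axis 1 1"] by (simp add: axis_eq_0_iff)
  next
    case False
    then obtain X v where "X \<in> M" "X *v v \<noteq> 0" by blast
    then show ?thesis using that[of "X *v v"] zero by blast
  qed
  show ?thesis
  proof (cases "\<forall>X\<in>M. \<forall>v. X *v v \<in> vec.span {a}")
    case True
    obtain b where b: "b \<notin> vec.span {a}"
      using exists_notin_span[of a a a] by auto
    obtain c where c: "c \<notin> vec.span {a, b}"
      using exists_notin_span[of a b b] by auto
    obtain d where d: "d \<notin> vec.span {a, b, c}"
      using exists_notin_span[of a b c] by auto
    have ?F3
    proof (intro exI[of _ "frame a b c d"] conjI ballI)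
      show "invertible (frame a b c d)"
        using a b c d by (intro invertible_frameI)
      fix X assume X: "X \<in> M"
      then have "\<exists>p. X *v v = p *s a" for v
        using True by (simp add: in_span_1_iff)
      then obtain p q s where "X *v b = p *s a" "X *v c = q *s a" "X *v d = s *s a"
        by metis
      then show "\<exists>\<alpha> \<beta> \<gamma>. (mat 1 + X) ** frame a b c d = frame a b c d ** matrix4
          [[1, \<alpha>, \<beta>, \<gamma>], [0, 1, 0, 0], [0, 0, 1, 0], [0, 0, 0, 1]]"
        using a X by (intro exI[of _ p] exI[of _ q] exI[of _ s])
          (simp add: frame_intertwines_iff matrix_vector_mult_add_rdistrib add.commute)
    qed
    then show ?thesis by blast
  next
    case False
    then obtain B u where B: "B \<in> M" and b: "B *v u \<notin> vec.span {a}" by blast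
    define b where "b = B *v u"
    have b: "b \<notin> vec.span {a}" and b0: "X \<in> M \<Longrightarrow> X *v b = 0" for X
      using b zero B by (auto simp: b_def)
    show ?thesis
    proof (cases "\<forall>X\<in>M. \<forall>v. X *v v \<in> vec.span {a, b}")
      case True
      obtain c where c: "c \<notin> vec.span {a, b}"
        using exists_notin_span[of a b b] by auto
      obtain d where d: "d \<notin> vec.span {a, b, c}"
        using exists_notin_span[of a b c] by auto
      have ?F4
      proof (intro exI[of _ "frame a b c d"] conjI ballI)
        show "invertible (frame a b c d)"
          using a b c d by (intro invertible_frameI)
        fix X assume X: "X \<in> M"
        obtain p q where pq: "X *v c = p *s a + q *s b"
          using True X unfolding in_span_2_iff by blast
        obtain s t where st: "X *v d = s *s a + t *s b"
          using True X unfolding in_span_2_iff by blast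
        show "\<exists>\<alpha> \<beta> \<gamma> \<delta>. (mat 1 + X) ** frame a b c d = frame a b c d ** matrix4
            [[1, 0, \<alpha>, \<beta>], [0, 1, \<gamma>, \<delta>], [0, 0, 1, 0], [0, 0, 0, 1]]"
          using a b0 X pq st by (intro exI[of _ p] exI[of _ s] exI[of _ q] exI[of _ t])
            (simp add: frame_intertwines_iff matrix_vector_mult_add_rdistrib add.commute)
      qed
      then show ?thesis by blast
    next
      case False
      then obtain C w where C: "C \<in> M" and c: "C *v w \<notin> vec.span {a, b}" by blast
      define c where "c = C *v w"
      have c: "c \<notin> vec.span {a, b}" and c0: "X \<in> M \<Longrightarrow> X *v c = 0" for X
        using c zero C by (auto simp: c_def)
      obtain d where d: "d \<notin> vec.span {a, b, c}"
        using exists_notin_span[of a b c] by auto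
      have fr: "invertible (frame a b c d)"
        using a b c d by (intro invertible_frameI)
      have ?F5
      proof (intro exI[of _ "frame a b c d"] conjI ballI)
        show "invertible (frame a b c d)" by (fact fr)
        fix X assume X: "X \<in> M"
        obtain p q s t where d_image: "X *v d = p *s a + q *s b + s *s c + t *s d"
          using fr by (rule frame_expand)
        \<comment> \<open>The expansion of \<open>X d\<close> may still involve \<open>d\<close>.
          Since \<open>a\<close>, \<open>b\<close>, \<open>c\<close> are killed, a second
          application of \<open>X\<close> leaves \<open>t X d = 0\<close>, which excludes this
          component unless \<open>X d = 0\<close>.\<close>
        have "X *v (p *s a + q *s b + s *s c + t *s d) = 0"
          using zero[OF X X, of d] d_image by simp
        then have "t *s (X *v d) = 0"
          using a b0 c0 X by (simp add: mult_vec_simps)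
        then have "X *v d = 0 \<or> t = 0" by auto
        then obtain p q s where "X *v d = p *s a + q *s b + s *s c"
        proof
          assume "X *v d = 0"
          then show ?thesis using that[of 0 0 0] by simp
        next
          assume "t = 0"
          then show ?thesis using that[of p q s] d_image by simp
        qed
        then show "\<exists>\<alpha> \<beta> \<gamma>. (mat 1 + X) ** frame a b c d = frame a b c d ** matrix4
            [[1, 0, 0, \<alpha>], [0, 1, 0, \<beta>], [0, 0, 1, \<gamma>], [0, 0, 0, 1]]"
          using a b0 c0 X by (intro exI[of _ p] exI[of _ q] exI[of _ s])
            (simp add: frame_intertwines_iff matrix_vector_mult_add_rdistrib add.commute)
      qed
      then show ?thesis by blast
    qed
  qed
qed

section \<open>All squares vanish, but some product does not\<close>

text \<open>Multiplying a relation among \<open>X Y v\<close>, \<open>X v\<close>,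
  \<open>Y v\<close>, \<open>v\<close> by \<open>X Y\<close>, \<open>Y\<close> and \<open>X\<close>
  isolates its coefficients, so these vectors form a basis. A further member \<open>Z\<close> of
  \<open>M\<close> is determined by \<open>Z v\<close>, because it commutes with \<open>X\<close>
  and \<open>Y\<close>.\<close>

lemma squares_zero_case:
  assumes square: "\<And>X v. X \<in> M \<Longrightarrow> X *v (X *v v) = 0"
    and X: "X \<in> M" and Y: "Y \<in> M" and nz: "X *v (Y *v v) \<noteq> 0"
  shows "\<exists>P. invertible P \<and> (\<forall>X\<in>M. \<exists>\<alpha> \<beta> \<gamma>. (mat 1 + X) ** P = P ** matrix4
    [[1, \<alpha>, \<beta>, \<gamma>], [0, 1, 0, \<beta>], [0, 0, 1, \<alpha>], [0, 0, 0, 1]])"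
proof -
  have YX: "Y *v (X *v u) = X *v (Y *v u)" for u
    using commute X Y by blast
  note rules = mult_vec_simps YX square[OF X] square[OF Y] triple_zero[OF _ X Y] triple_zero[OF X X Y]
  let ?P = "frame (X *v (Y *v v)) (X *v v) (Y *v v) v"
  have fr: "invertible ?P"
    unfolding invertible_frame_iff
  proof (intro allI impI)
    fix p q s t
    assume rel: "p *s (X *v (Y *v v)) + q *s (X *v v) + s *s (Y *v v) + t *s v = 0"
    have app: "A *v (p *s (X *v (Y *v v)) + q *s (X *v v) + s *s (Y *v v) + t *s v) = 0"
      for A :: "'k^4^4"
      using rel by simp
    have t: "t = 0" using app[of "X ** Y"] nz by (simp add: rules)
    have q: "q = 0" using app[of Y] nz t by (simp add: rules)
    have s: "s = 0" using app[of X] nz t by (simp add: rules)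
    have "p = 0" using rel nz q s t by simp
    with q s t show "p = 0 \<and> q = 0 \<and> s = 0 \<and> t = 0" by simp
  qed
  have "\<exists>\<alpha> \<beta> \<gamma>. (mat 1 + Z) ** ?P = ?P ** matrix4
      [[1, \<alpha>, \<beta>, \<gamma>], [0, 1, 0, \<beta>], [0, 0, 1, \<alpha>], [0, 0, 0, 1]]" if Z: "Z \<in> M" for Z
  proof -
    obtain p q s t where Zv: "Z *v v = p *s (X *v (Y *v v)) + q *s (X *v v) + s *s (Y *v v) + t *s v"
      using fr by (rule frame_expand)
    have app: "A *v (Z *v v) = A *v (p *s (X *v (Y *v v)) + q *s (X *v v) + s *s (Y *v v) + t *s v)"
      for A :: "'k^4^4"
      using Zv by simp
    have "t *s (X *v (Y *v v)) = 0"
      using app[of "X ** Y"] triple_zero[OF X Y Z] by (simp add: rules)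
    then have t: "t = 0" using nz by simp
    have ZX: "Z *v (X *v v) = s *s (X *v (Y *v v))"
      using app[of X] t commute[OF Z X] by (simp add: rules)
    have ZY: "Z *v (Y *v v) = q *s (X *v (Y *v v))"
      using app[of Y] t commute[OF Z Y] by (simp add: rules)
    \<comment> \<open>The coordinates cross over: as \<open>X X = Y Y = 0\<close>, the coefficient
      of \<open>Y v\<close> in \<open>Z v\<close> governs \<open>Z X v\<close>, and that of
      \<open>X v\<close> governs \<open>Z Y v\<close>.\<close>
    show ?thesis
      using Zv t ZX ZY triple_zero[OF Z X Y]
      by (intro exI[of _ s] exI[of _ q] exI[of _ p])
        (simp add: frame_intertwines_iff matrix_vector_mult_add_rdistrib add_ac)
  qed
  with fr show ?thesis by blast
qed

section \<open>Some square does not vanish\<close>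

text \<open>A Jordan chain is independent: if \<open>X v\<close> or \<open>v\<close> depended on the
  vectors before it, then applying \<open>X\<close> or \<open>X X\<close> would give
  \<open>X X v = 0\<close>.\<close>

lemma invertible_frame_square:
  assumes X: "X \<in> M" and nz: "X *v (X *v v) \<noteq> 0"
    and w: "w \<notin> vec.span {X *v (X *v v), X *v v, v}"
  shows "invertible (frame (X *v (X *v v)) (X *v v) v w)"
proof (rule invertible_frameI[OF nz _ _ w])
  show "X *v v \<notin> vec.span {X *v (X *v v)}"
  proof
    assume "X *v v \<in> vec.span {X *v (X *v v)}"
    then obtain p where "X *v v = p *s (X *v (X *v v))"
      by (auto simp: in_span_1_iff)
    then have "X *v (X *v v) = X *v (p *s (X *v (X *v v)))" by simp
    then show False using nz by (simp add: mult_vec_simps cube[OF X])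
  qed
  show "v \<notin> vec.span {X *v (X *v v), X *v v}"
  proof
    assume "v \<in> vec.span {X *v (X *v v), X *v v}"
    then obtain p q where "v = p *s (X *v (X *v v)) + q *s (X *v v)"
      by (auto simp: in_span_2_iff)
    then have "X *v (X *v v) = X *v (X *v (p *s (X *v (X *v v)) + q *s (X *v v)))" by simp
    then show False using nz by (simp add: mult_vec_simps cube[OF X])
  qed
qed

text \<open>A vector outside the span of the chain is corrected twice, by a multiple of
  \<open>v\<close> to make its image under \<open>X X\<close> vanish and then by a multiple of
  \<open>X v\<close> to make its image under \<open>X\<close> vanish. Neither correction moves it
  into the span.\<close>

lemma exists_complement_in_kernel:
  assumes X: "X \<in> M" and nz: "X *v (X *v v) \<noteq> 0"
  obtains w where "w \<notin> vec.span {X *v (X *v v), X *v v, v}" "X *v w = 0"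
proof -
  let ?S = "vec.span {X *v (X *v v), X *v v, v}"
  note rules = mult_vec_simps cube[OF X]
  obtain w where w: "w \<notin> ?S"
    using exists_notin_span by blast
  \<comment> \<open>Applying \<open>X X\<close> to the expansion of \<open>X w\<close> gives a
    relation between \<open>X X v\<close> and \<open>X X w\<close>. If it is trivial, applying
    \<open>X\<close> alone leaves \<open>X X w = q X X v\<close>.\<close>
  have "\<exists>t. X *v (X *v w) = t *s (X *v (X *v v))"
  proof -
    obtain p q r s where Xw: "X *v w = p *s (X *v (X *v v)) + q *s (X *v v) + r *s v + s *s w"
      using invertible_frame_square[OF X nz w] by (rule frame_expand)
    have app: "A *v (X *v w) = A *v (p *s (X *v (X *v v)) + q *s (X *v v) + r *s v + s *s w)"
      for A :: "'k^4^4"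
      using Xw by simp
    show ?thesis
    proof (rule in_line_if_relation[OF _ nz])
      show "r *s (X *v (X *v v)) + s *s (X *v (X *v w)) = 0"
        using app[of "X ** X"] by (simp add: rules)
      assume "r = 0" "s = 0"
      then show ?thesis
        using app[of X] by (auto simp: rules)
    qed
  qed
  then obtain t where t: "X *v (X *v w) = t *s (X *v (X *v v))" by blast
  define u where "u = w + (- t) *s v"
  have u: "u \<notin> ?S"
  proof
    assume "u \<in> ?S"
    then have "u + t *s v \<in> ?S"
      by (rule vec.span_add) (simp add: vec.span_scale vec.span_base)
    then show False using w by (simp add: u_def)
  qed
  have XXu: "X *v (X *v u) = 0"
    using t by (simp add: u_def rules matrix_vector_mult_diff_distrib)
  have "\<exists>c. X *v u = c *s (X *v (X *v v))"
  proof -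
    obtain p q r s where Xu: "X *v u = p *s (X *v (X *v v)) + q *s (X *v v) + r *s v + s *s u"
      using invertible_frame_square[OF X nz u] by (rule frame_expand)
    have app: "A *v (X *v u) = A *v (p *s (X *v (X *v v)) + q *s (X *v v) + r *s v + s *s u)"
      for A :: "'k^4^4"
      using Xu by simp
    have r: "r = 0"
      using app[of "X ** X"] nz by (simp add: rules XXu)
    show ?thesis
    proof (rule in_line_if_relation[OF _ nz])
      show "q *s (X *v (X *v v)) + s *s (X *v u) = 0"
        using app[of X] r by (simp add: rules XXu)
      assume "q = 0" "s = 0"
      then show ?thesis
        using Xu r by auto
    qed
  qed
  then obtain c where c: "X *v u = c *s (X *v (X *v v))" by blast
  show ?thesis
  proof (rule that)
    show "u + (- c) *s (X *v v) \<notin> ?S"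
    proof
      assume "u + (- c) *s (X *v v) \<in> ?S"
      then have "u + (- c) *s (X *v v) + c *s (X *v v) \<in> ?S"
        by (rule vec.span_add) (simp add: vec.span_scale vec.span_base)
      then show False using u by simp
    qed
    show "X *v (u + (- c) *s (X *v v)) = 0"
      unfolding mult_vec_simps c by simp
  qed
qed

text \<open>The chain \<open>X X v\<close>, \<open>X v\<close>, \<open>v\<close> spans a space
  stable under \<open>M\<close>, and it is completed by a vector \<open>w\<close> of the kernel of
  \<open>X\<close>. Every member of \<open>M\<close> acts on the chain as a polynomial in
  \<open>X\<close> without constant term and sends \<open>w\<close> to a multiple of
  \<open>X X v\<close>.\<close>

lemma square_nonzero_noncyclic_case:
  assumes X: "X \<in> M" and nz: "X *v (X *v v) \<noteq> 0"
    and span: "\<And>Y. Y \<in> M \<Longrightarrow> Y *v v \<in> vec.span {X *v (X *v v), X *v v, v}"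
  shows "\<exists>P. invertible P \<and> (\<forall>X\<in>M. \<exists>\<alpha> \<beta> \<gamma>. (mat 1 + X) ** P = P ** matrix4
    [[1, \<alpha>, \<beta>, \<gamma>], [0, 1, \<alpha>, 0], [0, 0, 1, 0], [0, 0, 0, 1]])"
proof -
  obtain w where w: "w \<notin> vec.span {X *v (X *v v), X *v v, v}" and Xw: "X *v w = 0"
    using exists_complement_in_kernel[OF X nz] .
  let ?P = "frame (X *v (X *v v)) (X *v v) v w"
  have fr: "invertible ?P"
    by (rule invertible_frame_square[OF X nz w])
  have "\<exists>\<alpha> \<beta> \<gamma>. (mat 1 + Y) ** ?P = ?P ** matrix4
    [[1, \<alpha>, \<beta>, \<gamma>], [0, 1, \<alpha>, 0], [0, 0, 1, 0], [0, 0, 0, 1]]" if Y: "Y \<in> M" for Y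
  proof -
    have YX: "Y *v (X *v u) = X *v (Y *v u)" for u
      using commute X Y by blast
    note rules = mult_vec_simps YX cube[OF X] cube[OF Y] Xw square_mult[OF X Y] triple_zero[OF X Y Y]
    obtain a b c where Yv: "Y *v v = a *s (X *v (X *v v)) + b *s (X *v v) + c *s v"
      using span[OF Y] by (auto simp: in_span_3_iff)
    have app: "A *v (Y *v v) = A *v (a *s (X *v (X *v v)) + b *s (X *v v) + c *s v)"
      for A :: "'k^4^4"
      using Yv by simp
    have c: "c = 0"
      using app[of "X ** X"] nz by (simp add: rules)
    have XYv: "X *v (Y *v v) = b *s (X *v (X *v v))"
      using app[of X] c by (simp add: rules)
    obtain p q r s where Yw: "Y *v w = p *s (X *v (X *v v)) + q *s (X *v v) + r *s v + s *s w"
      using fr by (rule frame_expand)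
    have app: "A *v (Y *v w) = A *v (p *s (X *v (X *v v)) + q *s (X *v v) + r *s v + s *s w)"
      for A :: "'k^4^4"
      using Yw by simp
    have XYw: "X *v (Y *v w) = 0" using YX[of w] Xw by simp
    have r: "r = 0"
      using app[of "X ** X"] nz XYw by (simp add: rules)
    have q: "q = 0"
      using app[of X] nz XYw r by (simp add: rules)
    have YYw: "Y *v (Y *v w) = s *s (Y *v w)"
      using app[of Y] q r by (simp add: rules)
    \<comment> \<open>\<open>Y w\<close> is an eigenvector for \<open>s\<close> or zero; the
      vanishing cube of \<open>Y\<close> forces \<open>s = 0\<close> or
      \<open>Y w = 0\<close>.\<close>
    have "Y *v (Y *v (Y *v w)) = s *s (s *s (Y *v w))"
      by (simp only: YYw vector_scalar_commute)
    then have "s = 0 \<or> Y *v w = 0"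
      by (simp add: cube[OF Y])
    then have "\<exists>d. Y *v w = d *s (X *v (X *v v))"
    proof
      assume "s = 0"
      then show ?thesis using Yw q r by auto
    next
      assume "Y *v w = 0"
      then show ?thesis by (intro exI[of _ 0]) simp
    qed
    then obtain d where "Y *v w = d *s (X *v (X *v v))" by blast
    then show ?thesis
      using Yv c XYv
      by (intro exI[of _ b] exI[of _ a] exI[of _ d])
        (simp add: frame_intertwines_iff matrix_vector_mult_add_rdistrib add_ac rules)
  qed
  with fr show ?thesis by blast
qed

text \<open>Here \<open>v\<close> is a cyclic vector: \<open>X X v\<close>, \<open>X v\<close>,
  \<open>v\<close>, \<open>Y v\<close> form a basis. Hence a matrix commuting with \<open>X\<close>
  and \<open>Y\<close> is determined by its value at \<open>v\<close>. Replacing \<open>Y v\<close>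
  by a vector \<open>w\<close> of the kernel of \<open>X\<close> leaves a single invariant, the
  factor \<kappa> with \<open>Y w = \<kappa> X X v\<close>.\<close>

lemma square_nonzero_cyclic_case:
  assumes X: "X \<in> M" and nz: "X *v (X *v v) \<noteq> 0"
    and Y: "Y \<in> M" and notin: "Y *v v \<notin> vec.span {X *v (X *v v), X *v v, v}"
  shows "(\<exists>P. invertible P \<and> (\<forall>X\<in>M. \<exists>\<alpha> \<beta> \<gamma>. (mat 1 + X) ** P = P ** matrix4
      [[1, 0, 0, \<gamma>], [0, 1, \<alpha>, \<beta>], [0, 0, 1, \<alpha>], [0, 0, 0, 1]])) \<or>
    (\<exists>\<nu>. \<nu> \<noteq> 0 \<and> (\<exists>P. invertible P \<and> (\<forall>X\<in>M. \<exists>\<alpha> \<beta> \<gamma>. (mat 1 + X) ** P = P ** matrix4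
      [[1, \<alpha>, \<beta>, \<gamma>], [0, 1, 0, \<alpha>], [0, 0, 1, \<nu> * \<beta>], [0, 0, 0, 1]])))"
proof -
  let ?S = "vec.span {X *v (X *v v), X *v v, v}"
  have YX: "Y *v (X *v u) = X *v (Y *v u)" for u
    using commute X Y by blast
  note rules = mult_vec_simps YX cube[OF X] cube[OF Y] square_mult[OF X Y] triple_zero[OF X Y Y]
  have "\<exists>t. X *v (Y *v v) = t *s (X *v (X *v v))"
  proof -
    obtain p q r s where XYv: "X *v (Y *v v) =
        p *s (X *v (X *v v)) + q *s (X *v v) + r *s v + s *s (Y *v v)"
      using invertible_frame_square[OF X nz notin] by (rule frame_expand)
    have app: "A *v (X *v (Y *v v)) =
        A *v (p *s (X *v (X *v v)) + q *s (X *v v) + r *s v + s *s (Y *v v))" for A :: "'k^4^4"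
      using XYv by simp
    have r: "r = 0"
      using app[of "X ** X"] nz by (simp add: rules)
    show ?thesis
    proof (rule in_line_if_relation[OF _ nz])
      show "q *s (X *v (X *v v)) + s *s (X *v (Y *v v)) = 0"
        using app[of X] r by (simp add: rules)
      assume "q = 0" "s = 0"
      then show ?thesis using XYv r by auto
    qed
  qed
  then obtain t where t: "X *v (Y *v v) = t *s (X *v (X *v v))" by blast
  define w where "w = Y *v v + (- t) *s (X *v v)"
  have w: "w \<notin> ?S"
  proof
    assume "w \<in> ?S"
    then have "w + t *s (X *v v) \<in> ?S"
      by (rule vec.span_add) (simp add: vec.span_scale vec.span_base)
    then show False using notin by (simp add: w_def)
  qed
  have Xw: "X *v w = 0"
    unfolding w_def mult_vec_simps t by simp
  have fr: "invertible (frame (X *v (X *v v)) (X *v v) v w)"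
    by (rule invertible_frame_square[OF X nz w])
  have XYw: "X *v (Y *v w) = 0" using YX[of w] Xw by simp
  have YYw: "Y *v (Y *v w) = 0"
    unfolding w_def mult_vec_simps using YX[of v] triple_zero[OF Y X Y] cube[OF Y] by simp
  have "\<exists>\<kappa>. Y *v w = \<kappa> *s (X *v (X *v v))"
  proof -
    obtain p q r s where Yw: "Y *v w = p *s (X *v (X *v v)) + q *s (X *v v) + r *s v + s *s w"
      using fr by (rule frame_expand)
    have app: "A *v (Y *v w) = A *v (p *s (X *v (X *v v)) + q *s (X *v v) + r *s v + s *s w)"
      for A :: "'k^4^4"
      using Yw by simp
    have r: "r = 0"
      using app[of "X ** X"] nz XYw by (simp add: rules Xw)
    have q: "q = 0"
      using app[of X] nz XYw r by (simp add: rules Xw)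
    have "s *s (Y *v w) = 0"
      using app[of Y] q r YYw by (simp add: rules)
    \<comment> \<open>The zero multiple only gives the relation the required shape: either
      \<open>Y w = 0\<close>, or \<open>s = 0\<close> and the expansion reduces to its first
      term.\<close>
    then have "0 *s (X *v (X *v v)) + s *s (Y *v w) = 0"
      by simp
    then show ?thesis
      by (rule in_line_if_relation[OF _ nz]) (use Yw q r in auto)
  qed
  then obtain \<kappa> where \<kappa>: "Y *v w = \<kappa> *s (X *v (X *v v))" by blast
  have action: "\<exists>a b c. Z *v v = a *s (X *v (X *v v)) + b *s (X *v v) + c *s w \<and>
      Z *v (X *v v) = b *s (X *v (X *v v)) \<and> Z *v w = (c * \<kappa>) *s (X *v (X *v v)) \<and>
      Z *v (X *v (X *v v)) = 0" if Z: "Z \<in> M" for Z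
  proof -
    obtain a b r c where Zv: "Z *v v = a *s (X *v (X *v v)) + b *s (X *v v) + r *s v + c *s w"
      using fr by (rule frame_expand)
    have app: "A *v (Z *v v) = A *v (a *s (X *v (X *v v)) + b *s (X *v v) + r *s v + c *s w)"
      for A :: "'k^4^4"
      using Zv by simp
    have r: "r = 0"
      using app[of "X ** X"] nz square_mult[OF X Z] by (simp add: rules Xw)
    have XZ: "X *v (Z *v v) = b *s (X *v (X *v v))"
      using app[of X] r by (simp add: rules Xw)
    have YZ: "Y *v (Z *v v) = b *s (t *s (X *v (X *v v))) + c *s (\<kappa> *s (X *v (X *v v)))"
      using app[of Y] r by (simp add: rules \<kappa> t)
    \<comment> \<open>As \<open>w\<close> arises from \<open>v\<close> by applying
      \<open>Y - t X\<close>, which commutes with \<open>Z\<close>, its image is computed from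
      \<open>Z v\<close>. The terms with \<open>b t\<close> cancel.\<close>
    have "Z *v w = Y *v (Z *v v) + (- t) *s (X *v (Z *v v))"
      unfolding w_def mult_vec_simps using commute[OF Z X] commute[OF Z Y] by simp
    then have "Z *v w = (c * \<kappa>) *s (X *v (X *v v))"
      unfolding YZ XZ by (simp add: mult.commute)
    then show ?thesis
      using Zv r XZ commute[OF Z X, of v] triple_zero[OF Z X X, of v]
      by (intro exI[of _ a] exI[of _ b] exI[of _ c]) simp
  qed
  show ?thesis
  proof (cases "\<kappa> = 0")
    case True
    have "\<exists>\<alpha> \<beta> \<gamma>. (mat 1 + Z) ** frame w (X *v (X *v v)) (X *v v) v =
        frame w (X *v (X *v v)) (X *v v) v ** matrix4
        [[1, 0, 0, \<gamma>], [0, 1, \<alpha>, \<beta>], [0, 0, 1, \<alpha>], [0, 0, 0, 1]]" if Z: "Z \<in> M" for Z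
    proof -
      obtain a b c where "Z *v v = a *s (X *v (X *v v)) + b *s (X *v v) + c *s w"
        "Z *v (X *v v) = b *s (X *v (X *v v))" "Z *v w = (c * \<kappa>) *s (X *v (X *v v))"
        "Z *v (X *v (X *v v)) = 0"
        using action[OF Z] by blast
      then show ?thesis
        using True by (intro exI[of _ b] exI[of _ a] exI[of _ c])
          (simp add: frame_intertwines_iff matrix_vector_mult_add_rdistrib add_ac)
    qed
    moreover have "invertible (frame w (X *v (X *v v)) (X *v v) v)"
      using fr by (rule invertible_frame_rotate)
    ultimately show ?thesis by blast
  next
    case False
    have "\<exists>\<alpha> \<beta> \<gamma>. (mat 1 + Z) ** frame (X *v (X *v v)) (X *v v) w v =
        frame (X *v (X *v v)) (X *v v) w v ** matrix4
        [[1, \<alpha>, \<beta>, \<gamma>], [0, 1, 0, \<alpha>], [0, 0, 1, inverse \<kappa> * \<beta>], [0, 0, 0, 1]]"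
      if Z: "Z \<in> M" for Z
    proof -
      obtain a b c where "Z *v v = a *s (X *v (X *v v)) + b *s (X *v v) + c *s w"
        "Z *v (X *v v) = b *s (X *v (X *v v))" "Z *v w = (c * \<kappa>) *s (X *v (X *v v))"
        "Z *v (X *v (X *v v)) = 0"
        using action[OF Z] by blast
      then show ?thesis
        \<comment> \<open>The third entry of the first row is \<open>c * \<kappa>\<close>, while the
          coefficient of \<open>w\<close> in \<open>Z v\<close> is \<open>c\<close>; this is why the
          constant is \<open>inverse \<kappa>\<close>.\<close>
        using False by (intro exI[of _ b] exI[of _ "c * \<kappa>"] exI[of _ a])
          (simp add: frame_intertwines_iff matrix_vector_mult_add_rdistrib add_ac)
    qed
    moreover have "invertible (frame (X *v (X *v v)) (X *v v) w v)"
      using fr by (rule invertible_frame_swap)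
    ultimately show ?thesis
      using False by (intro disjI2 exI[of _ "inverse \<kappa>"]) auto
  qed
qed

section \<open>Collecting the cases\<close>

text \<open>The cases are a nonzero square, a nonzero product while all squares vanish, and no
  nonzero product. One \<open>P\<close> is chosen in front of the disjunction, so that the
  conjugated representation can be fixed before the forms are told apart.\<close>

lemma normal_form:
  "\<exists>P. invertible P \<and>
    ((\<forall>X\<in>M. \<exists>\<alpha> \<beta> \<gamma>. (mat 1 + X) ** P = P ** matrix4
        [[1, \<alpha>, \<beta>, \<gamma>], [0, 1, \<alpha>, 0], [0, 0, 1, 0], [0, 0, 0, 1]]) \<or>
     (\<forall>X\<in>M. \<exists>\<alpha> \<beta> \<gamma>. (mat 1 + X) ** P = P ** matrix4
        [[1, 0, 0, \<gamma>], [0, 1, \<alpha>, \<beta>], [0, 0, 1, \<alpha>], [0, 0, 0, 1]]) \<or>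
     (\<forall>X\<in>M. \<exists>\<alpha> \<beta> \<gamma>. (mat 1 + X) ** P = P ** matrix4
        [[1, \<alpha>, \<beta>, \<gamma>], [0, 1, 0, 0], [0, 0, 1, 0], [0, 0, 0, 1]]) \<or>
     (\<forall>X\<in>M. \<exists>\<alpha> \<beta> \<gamma> \<delta>. (mat 1 + X) ** P = P ** matrix4
        [[1, 0, \<alpha>, \<beta>], [0, 1, \<gamma>, \<delta>], [0, 0, 1, 0], [0, 0, 0, 1]]) \<or>
     (\<forall>X\<in>M. \<exists>\<alpha> \<beta> \<gamma>. (mat 1 + X) ** P = P ** matrix4
        [[1, 0, 0, \<alpha>], [0, 1, 0, \<beta>], [0, 0, 1, \<gamma>], [0, 0, 0, 1]]) \<or>
     (\<exists>l \<mu> \<nu>. l * \<nu> - \<mu>\<^sup>2 \<noteq> 0 \<and>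
       (\<forall>X\<in>M. \<exists>\<alpha> \<beta> \<gamma>. (mat 1 + X) ** P = P ** matrix4
        [[1, \<alpha>, \<beta>, \<gamma>], [0, 1, 0, l * \<alpha> + \<mu> * \<beta>], [0, 0, 1, \<mu> * \<alpha> + \<nu> * \<beta>], [0, 0, 0, 1]])))"
    (is "\<exists>P. invertible P \<and> (?F1 P \<or> ?F2 P \<or> ?F3 P \<or> ?F4 P \<or> ?F5 P \<or> ?F6 P)")
proof -
  consider (square) X v where "X \<in> M" "X *v (X *v v) \<noteq> 0"
    | (mixed) X Y v where "\<And>X v. X \<in> M \<Longrightarrow> X *v (X *v v) = 0" "X \<in> M" "Y \<in> M" "X *v (Y *v v) \<noteq> 0"
    | (zero) "\<And>X Y v. X \<in> M \<Longrightarrow> Y \<in> M \<Longrightarrow> X *v (Y *v v) = 0"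
    by metis
  then show ?thesis
  proof cases
    case square
    show ?thesis
    proof (cases "\<forall>Y\<in>M. Y *v v \<in> vec.span {X *v (X *v v), X *v v, v}")
      case True
      then have "\<exists>P. invertible P \<and> ?F1 P"
        using square by (intro square_nonzero_noncyclic_case) auto
      then show ?thesis by blast
    next
      case False
      then obtain Y where Y: "Y \<in> M" "Y *v v \<notin> vec.span {X *v (X *v v), X *v v, v}"
        by blast
      from square_nonzero_cyclic_case[OF square Y] show ?thesis
      proof
        assume "\<exists>P. invertible P \<and> ?F2 P"
        then show ?thesis by blast
      next
        assume "\<exists>\<nu>. \<nu> \<noteq> 0 \<and> (\<exists>P. invertible P \<and> (\<forall>X\<in>M. \<exists>\<alpha> \<beta> \<gamma>. (mat 1 + X) ** P = P ** matrix4
          [[1, \<alpha>, \<beta>, \<gamma>], [0, 1, 0, \<alpha>], [0, 0, 1, \<nu> * \<beta>], [0, 0, 0, 1]]))"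
        then obtain \<nu> P where \<nu>: "\<nu> \<noteq> 0" and P: "invertible P" "\<forall>X\<in>M. \<exists>\<alpha> \<beta> \<gamma>. (mat 1 + X) ** P = P ** matrix4
          [[1, \<alpha>, \<beta>, \<gamma>], [0, 1, 0, \<alpha>], [0, 0, 1, \<nu> * \<beta>], [0, 0, 0, 1]]"
          by blast
        have "?F6 P"
          \<comment> \<open>A diagonal quadratic form, with determinant \<nu>.\<close>
          using \<nu> P(2) by (intro exI[of _ 1] exI[of _ 0] exI[of _ \<nu>]) simp
        with P(1) show ?thesis by blast
      qed
    qed
  next
    case mixed
    then obtain P where P: "invertible P" "\<forall>X\<in>M. \<exists>\<alpha> \<beta> \<gamma>. (mat 1 + X) ** P = P ** matrix4
        [[1, \<alpha>, \<beta>, \<gamma>], [0, 1, 0, \<beta>], [0, 0, 1, \<alpha>], [0, 0, 0, 1]]"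
      using squares_zero_case by metis
    have "?F6 P"
      \<comment> \<open>The hyperbolic plane, with determinant \<open>- 1\<close>.\<close>
      using P(2) by (intro exI[of _ 0] exI[of _ 1] exI[of _ 0]) simp
    with P(1) show ?thesis by blast
  next
    case zero
    from products_zero_cases[OF this] show ?thesis by blast
  qed
qed

end

section \<open>From representations to sets of matrices and back\<close>

lemma elementary_abelian_group_mult_commute:
  "g \<otimes>\<^bsub>elementary_abelian_group p r\<^esub> h = h \<otimes>\<^bsub>elementary_abelian_group p r\<^esub> g"
  by (simp add: elementary_abelian_group_def mult_integer_mod_group add.commute fun_eq_iff)

lemma elementary_abelian_group_3_cube:
  assumes "g \<in> carrier (elementary_abelian_group 3 r)"
  shows "g \<otimes>\<^bsub>elementary_abelian_group 3 r\<^esub> (g \<otimes>\<^bsub>elementary_abelian_group 3 r\<^esub> g)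
    = \<one>\<^bsub>elementary_abelian_group 3 r\<^esub>"
proof -
  have "(k + (k + k) mod 3) mod 3 = (0::int)" for k by presburger
  then show ?thesis
    by (simp add: elementary_abelian_group_def mult_integer_mod_group fun_eq_iff)
qed

lemma matrix_inv_inverse:
  assumes "invertible A"
  shows "A ** matrix_inv A = mat 1" "matrix_inv A ** A = mat 1"
  using someI_ex[OF assms[unfolded invertible_def]] by (simp_all add: matrix_inv_def)

lemma matrix_representation_conjugate:
  assumes "matrix_representation G \<rho>" "invertible P"
  shows "matrix_representation G (\<lambda>g. matrix_inv P ** \<rho> g ** P)"
proof -
  have "matrix_inv P ** A ** P ** (matrix_inv P ** B ** P) = matrix_inv P ** (A ** B) ** P" for A B
  proof -
    have "matrix_inv P ** A ** P ** (matrix_inv P ** B ** P)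
        = matrix_inv P ** A ** (P ** matrix_inv P) ** B ** P"
      by (simp add: matrix_mul_assoc)
    then show ?thesis
      using assms(2) by (simp add: matrix_inv_inverse matrix_mul_assoc)
  qed
  moreover have "invertible (matrix_inv P)"
    using matrix_inv_inverse[OF assms(2)] by (auto simp: invertible_def)
  ultimately show ?thesis
    using assms
    by (auto simp: matrix_representation_def hom_def general_linear_group_def Pi_iff invertible_mult)
qed

text \<open>For \<open>A = \<rho> g\<close> the group law gives \<open>A A A = 1\<close>, and in
  characteristic 3 the cube of \<open>A - 1\<close> is \<open>A A A - 1 = 0\<close>. Commutativity
  is inherited from the group.\<close>

lemma commuting_cube_zero_representation:
  fixes \<rho> :: "(nat \<Rightarrow> int) \<Rightarrow> 'k::field^4^4"
  assumes char: "CHAR('k) = 3"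
    and rep: "matrix_representation (elementary_abelian_group 3 r) \<rho>"
  shows "commuting_cube_zero ((\<lambda>g. \<rho> g - mat 1) ` carrier (elementary_abelian_group 3 r))"
proof -
  let ?G = "elementary_abelian_group 3 r"
  interpret group ?G by (rule group_elementary_abelian_group)
  interpret GL: group "general_linear_group :: ('k^4^4) monoid"
    by (rule group_general_linear_group)
  interpret group_hom ?G general_linear_group \<rho>
    using rep by unfold_locales (simp add: matrix_representation_def)
  have mult: "\<rho> g *v (\<rho> h *v v) = \<rho> (g \<otimes>\<^bsub>?G\<^esub> h) *v v"
    if "g \<in> carrier ?G" "h \<in> carrier ?G" for g h v
    using that by (simp add: general_linear_group_def matrix_vector_mul_assoc)
  have one: "\<rho> \<one>\<^bsub>?G\<^esub> = mat 1"
    using hom_one by (simp add: general_linear_group_def)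
  have "(3::'k) = 0"
    using of_nat_CHAR[where 'a='k] char by simp
  then have "x + x + x = 0" for x :: 'k
    using mult_2[of x] distrib_right[of 2 1 x] by simp
  then have thrice: "x + x + x = 0" for x :: "'k^4"
    by (simp add: vec_eq_iff)
  show ?thesis
  proof
    fix X Y :: "'k^4^4" and v
    assume "X \<in> (\<lambda>g. \<rho> g - mat 1) ` carrier ?G" "Y \<in> (\<lambda>g. \<rho> g - mat 1) ` carrier ?G"
    then obtain g h where gh: "g \<in> carrier ?G" "h \<in> carrier ?G" and XY: "X = \<rho> g - mat 1" "Y = \<rho> h - mat 1"
      by blast
    have "\<rho> g *v (\<rho> h *v v) = \<rho> h *v (\<rho> g *v v)"
      using gh elementary_abelian_group_mult_commute[of 3 r g h] by (simp add: mult del: hom_mult)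
    then show "X *v (Y *v v) = Y *v (X *v v)"
      by (simp add: XY matrix_vector_mult_diff_distrib matrix_vector_mult_diff_rdistrib)
  next
    fix X :: "'k^4^4" and v
    assume "X \<in> (\<lambda>g. \<rho> g - mat 1) ` carrier ?G"
    then obtain g where g: "g \<in> carrier ?G" and X: "X = \<rho> g - mat 1"
      by blast
    have "\<rho> g *v (\<rho> g *v (\<rho> g *v v)) = v"
      using g by (simp add: mult one elementary_abelian_group_3_cube del: hom_mult hom_one)
    then have "X *v (X *v (X *v v)) =
        v - \<rho> g *v (\<rho> g *v v) - (\<rho> g *v (\<rho> g *v v) - \<rho> g *v v)
        - (\<rho> g *v (\<rho> g *v v) - \<rho> g *v v - (\<rho> g *v v - v))"
      by (simp only: X matrix_vector_mult_diff_distrib matrix_vector_mult_diff_rdistrib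
          matrix_vector_mul_lid)
    \<comment> \<open>The outer terms \<open>v\<close> cancel, and the middle binomial terms are
      grouped into sums of three equal vectors.\<close>
    also have "\<dots> = (\<rho> g *v v + \<rho> g *v v + \<rho> g *v v)
        - (\<rho> g *v (\<rho> g *v v) + \<rho> g *v (\<rho> g *v v) + \<rho> g *v (\<rho> g *v v))"
      by (simp add: vec_eq_iff)
    finally show "X *v (X *v (X *v v)) = 0"
      by (simp only: thrice diff_self)
  qed
qed

text \<open>Parameters found separately for each generator are turned into families indexed by
  \<open>i\<close>, as the forms require.\<close>

lemma bchoice_3:
  "\<forall>i\<in>I. \<exists>a b c. Q i a b c \<Longrightarrow> \<exists>a b c. \<forall>i\<in>I. Q i (a i) (b i) (c i)"
  by metis

lemma bchoice_4:
  "\<forall>i\<in>I. \<exists>a b c d. Q i a b c d \<Longrightarrow> \<exists>a b c d. \<forall>i\<in>I. Q i (a i) (b i) (c i) (d i)"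
  by metis

theorem theorem5p9:
  fixes r :: nat and \<rho> :: "(nat \<Rightarrow> int) \<Rightarrow> 'k::field^4^4"
  assumes "CHAR('k) = 3"
    and "r \<ge> 1"
    and "matrix_representation (elementary_abelian_group 3 r) \<rho>"
  shows "\<exists>\<rho>' :: (nat \<Rightarrow> int) \<Rightarrow> 'k^4^4.
    matrix_representation (elementary_abelian_group 3 r) \<rho>' \<and>
    equivalent_representations (elementary_abelian_group 3 r) \<rho> \<rho>' \<and>
    ((\<exists>\<alpha> \<beta> \<gamma> :: nat \<Rightarrow> 'k. \<forall>i\<in>{1..r}. \<rho>' (std_gen 3 r i) = matrix4
        [[1, \<alpha> i, \<beta> i, \<gamma> i],
         [0, 1, \<alpha> i, 0],
         [0, 0, 1, 0],
         [0, 0, 0, 1]]) \<or>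
     (\<exists>\<alpha> \<beta> \<gamma> :: nat \<Rightarrow> 'k. \<forall>i\<in>{1..r}. \<rho>' (std_gen 3 r i) = matrix4
        [[1, 0, 0, \<gamma> i],
         [0, 1, \<alpha> i, \<beta> i],
         [0, 0, 1, \<alpha> i],
         [0, 0, 0, 1]]) \<or>
     (\<exists>\<alpha> \<beta> \<gamma> :: nat \<Rightarrow> 'k. \<forall>i\<in>{1..r}. \<rho>' (std_gen 3 r i) = matrix4
        [[1, \<alpha> i, \<beta> i, \<gamma> i],
         [0, 1, 0, 0],
         [0, 0, 1, 0],
         [0, 0, 0, 1]]) \<or>
     (\<exists>\<alpha> \<beta> \<gamma> \<delta> :: nat \<Rightarrow> 'k. \<forall>i\<in>{1..r}. \<rho>' (std_gen 3 r i) = matrix4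
        [[1, 0, \<alpha> i, \<beta> i],
         [0, 1, \<gamma> i, \<delta> i],
         [0, 0, 1, 0],
         [0, 0, 0, 1]]) \<or>
     (\<exists>\<alpha> \<beta> \<gamma> :: nat \<Rightarrow> 'k. \<forall>i\<in>{1..r}. \<rho>' (std_gen 3 r i) = matrix4
        [[1, 0, 0, \<alpha> i],
         [0, 1, 0, \<beta> i],
         [0, 0, 1, \<gamma> i],
         [0, 0, 0, 1]]) \<or>
     (\<exists>(\<alpha> :: nat \<Rightarrow> 'k) (\<beta> :: nat \<Rightarrow> 'k) (\<gamma> :: nat \<Rightarrow> 'k) (l :: 'k) (\<mu> :: 'k) (\<nu> :: 'k).
        l * \<nu> - \<mu>\<^sup>2 \<noteq> 0 \<and> (\<forall>i\<in>{1..r}. \<rho>' (std_gen 3 r i) = matrix4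
        [[1, \<alpha> i, \<beta> i, \<gamma> i],
         [0, 1, 0, l * \<alpha> i + \<mu> * \<beta> i],
         [0, 0, 1, \<mu> * \<alpha> i + \<nu> * \<beta> i],
         [0, 0, 0, 1]])))"
proof -
  let ?G = "elementary_abelian_group 3 r"
  let ?M = "(\<lambda>g. \<rho> g - mat 1) ` carrier ?G"
  interpret commuting_cube_zero ?M
    using assms(1,3) by (rule commuting_cube_zero_representation)
  obtain P where P: "invertible P" and forms: "
     (\<forall>X\<in>?M. \<exists>\<alpha> \<beta> \<gamma>. (mat 1 + X) ** P = P ** matrix4
        [[1, \<alpha>, \<beta>, \<gamma>], [0, 1, \<alpha>, 0], [0, 0, 1, 0], [0, 0, 0, 1]]) \<or>
     (\<forall>X\<in>?M. \<exists>\<alpha> \<beta> \<gamma>. (mat 1 + X) ** P = P ** matrix4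
        [[1, 0, 0, \<gamma>], [0, 1, \<alpha>, \<beta>], [0, 0, 1, \<alpha>], [0, 0, 0, 1]]) \<or>
     (\<forall>X\<in>?M. \<exists>\<alpha> \<beta> \<gamma>. (mat 1 + X) ** P = P ** matrix4
        [[1, \<alpha>, \<beta>, \<gamma>], [0, 1, 0, 0], [0, 0, 1, 0], [0, 0, 0, 1]]) \<or>
     (\<forall>X\<in>?M. \<exists>\<alpha> \<beta> \<gamma> \<delta>. (mat 1 + X) ** P = P ** matrix4
        [[1, 0, \<alpha>, \<beta>], [0, 1, \<gamma>, \<delta>], [0, 0, 1, 0], [0, 0, 0, 1]]) \<or>
     (\<forall>X\<in>?M. \<exists>\<alpha> \<beta> \<gamma>. (mat 1 + X) ** P = P ** matrix4
        [[1, 0, 0, \<alpha>], [0, 1, 0, \<beta>], [0, 0, 1, \<gamma>], [0, 0, 0, 1]]) \<or>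
     (\<exists>l \<mu> \<nu>. l * \<nu> - \<mu>\<^sup>2 \<noteq> 0 \<and>
       (\<forall>X\<in>?M. \<exists>\<alpha> \<beta> \<gamma>. (mat 1 + X) ** P = P ** matrix4
        [[1, \<alpha>, \<beta>, \<gamma>], [0, 1, 0, l * \<alpha> + \<mu> * \<beta>], [0, 0, 1, \<mu> * \<alpha> + \<nu> * \<beta>], [0, 0, 0, 1]]))"
    using normal_form by blast
  define \<rho>' where "\<rho>' g = matrix_inv P ** \<rho> g ** P" for g
  have rep: "matrix_representation ?G \<rho>'"
    unfolding \<rho>'_def using assms(3) P by (rule matrix_representation_conjugate)
  have equiv: "equivalent_representations ?G \<rho> \<rho>'"
    using P by (auto simp: equivalent_representations_def general_linear_group_def \<rho>'_def)
  have gen: "\<rho> (std_gen 3 r i) - mat 1 \<in> ?M" for i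
    using std_gen_in_carrier[of 3 r i] by auto
  \<comment> \<open>The intertwining relation avoids inverses in all case lemmas; only here is it
    turned into a conjugation.\<close>
  have conj: "\<rho>' g = C" if "(mat 1 + (\<rho> g - mat 1)) ** P = P ** C" for g C
  proof -
    have "\<rho> g ** P = P ** C" using that by simp
    then have "\<rho>' g = matrix_inv P ** P ** C"
      by (simp add: \<rho>'_def flip: matrix_mul_assoc)
    then show ?thesis using P by (simp add: matrix_inv_inverse)
  qed
  show ?thesis
  proof (rule exI[of _ \<rho>'], rule conjI[OF rep], rule conjI[OF equiv], insert forms,
      elim disjE exE conjE, goal_cases)
    case 1
    show ?case
      by (rule disjI1, rule bchoice_3, intro ballI) (use 1 gen conj in fast)
  next
    case 2
    show ?case
      by (rule disjI2, rule disjI1, rule bchoice_3, intro ballI) (use 2 gen conj in fast)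
  next
    case 3
    show ?case
      by (rule disjI2, rule disjI2, rule disjI1, rule bchoice_3, intro ballI)
        (use 3 gen conj in fast)
  next
    case 4
    show ?case
      by (rule disjI2, rule disjI2, rule disjI2, rule disjI1, rule bchoice_4, intro ballI)
        (use 4 gen conj in fast)
  next
    case 5
    show ?case
      by (rule disjI2, rule disjI2, rule disjI2, rule disjI2, rule disjI1,
          rule bchoice_3, intro ballI) (use 5 gen conj in fast)
  next
    case (6 l \<mu> \<nu>)
    \<comment> \<open>The three constants serve the whole group and are fixed before the families
      are chosen, hence do not depend on \<open>i\<close>.\<close>
    have "\<exists>\<alpha> \<beta> \<gamma>. \<forall>i\<in>{1..r}. \<rho>' (std_gen 3 r i) = matrix4
        [[1, \<alpha> i, \<beta> i, \<gamma> i], [0, 1, 0, l * \<alpha> i + \<mu> * \<beta> i],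
         [0, 0, 1, \<mu> * \<alpha> i + \<nu> * \<beta> i], [0, 0, 0, 1]]"
      by (rule bchoice_3, intro ballI) (use 6 gen conj in fast)
    then show ?case
      by (intro disjI2) (use 6(1) in fast)
  qed
qed

end
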